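(* Let $n \geq 3$ and $1 \leq k \leq n-1$ be integers, let $\eta_0,\dots,\eta_{n-1}$ be real numbers with $\eta_j \geq 0$ for $j=0,\dots,n-1$ and $\eta_0\eta_k \neq 0$, and consider the real polynomial $$\phi(x)=x^{n} + \eta_{n-1} x^{n-1} + \dots + \eta_{k+1} x^{k+1} - \eta_k x^{k} + \eta_{k-1} x^{k-1} + \dots + \eta_0 .$$ Then $\phi$ has two distinct positive roots if and only if $\phi(x^{*})<0$, where $x^{*}$ is the unique positive root of the polynomial $$\chi(x) = (n-k)x^{n} + (n-k-1)\eta_{n-1} x^{n-1} + \dots + \eta_{k+1} x^{k+1} - \eta_{k-1} x^{k-1} - 2\eta_{k-2} x^{k-2} - \dots - k\eta_0 .$$
   Context: With the convention $\eta_n=1$, the polynomial $\phi$ is $\phi(x)=\sum_{0\le j\le n,\, j\neq k}\eta_j x^j-\eta_k x^k$ (the coefficient of $x^k$ is the only one with a minus sign), and $\chi(x)=\sum_{j=0}^{n}(j-k)\eta_j x^j$ (the coefficient of $x^k$ is zero). *)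

theory Defs
  imports Complex_Main "HOL-Computational_Algebra.Polynomial"
begin

text \<open>
  The coefficients are given as a function \<open>\<eta>\<close> on the naturals, of which only the values
  \<open>\<eta> 0, \<dots>, \<eta> n\<close> matter. The convention \<open>\<eta> n = 1\<close> is not built into the definitions; theorems
  have to assume it.
\<close>

definition phi :: "nat \<Rightarrow> nat \<Rightarrow> (nat \<Rightarrow> real) \<Rightarrow> real poly" where
  "phi n k \<eta> = (\<Sum>j\<in>{0..n} - {k}. monom (\<eta> j) j) - monom (\<eta> k) k"

definition chi :: "nat \<Rightarrow> nat \<Rightarrow> (nat \<Rightarrow> real) \<Rightarrow> real poly" where
  "chi n k \<eta> = (\<Sum>j=0..n. monom ((real j - real k) * \<eta> j) j)"

end

theory Submission
  imports Defs
begin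

text \<open>
  On the positive half-line, \<open>\<phi>(x) / x ^ k\<close> has derivative \<open>\<chi>(x) / x ^ (k + 1)\<close>, and
  \<open>\<chi>(x) / x ^ k\<close> is strictly increasing since each term \<open>(j - k) \<eta>\<^sub>j x ^ (j - k)\<close> is nondecreasing,
  strictly so for \<open>j = 0\<close>.
  So \<open>\<chi>\<close> changes sign exactly once, from negative to positive, and \<open>\<phi>(x) / x ^ k\<close> strictly decreases
  up to \<open>x\<^sup>*\<close> and strictly increases afterwards. As \<open>\<phi>\<close> is positive at \<open>0\<close> and near infinity, it has
  two positive roots precisely when it is negative at the minimum point \<open>x\<^sup>*\<close>.
\<close>

lemma coeff_phi:
  "k \<le> n \<Longrightarrow> coeff (phi n k \<eta>) j = (if j = k then - \<eta> k else if j \<le> n then \<eta> j else 0)"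
  by (auto simp: phi_def coeff_sum)

lemma coeff_chi: "coeff (chi n k \<eta>) j = (if j \<le> n then (real j - real k) * \<eta> j else 0)"
  by (simp add: chi_def coeff_sum)

text \<open>The operator \<open>x * d/dx - k\<close> multiplies the coefficient of
  \<open>x ^ j\<close> by \<open>j - k\<close>. This factor vanishes at \<open>j = k\<close>, so the
  minus sign of \<open>\<eta> k\<close> in \<open>phi\<close> leaves no trace.\<close>

lemma chi_eq_pderiv_phi:
  assumes "k \<le> n"
  shows "chi n k \<eta> = pCons 0 (pderiv (phi n k \<eta>)) - smult (real k) (phi n k \<eta>)"
proof (rule poly_eqI)
  fix j
  show "coeff (chi n k \<eta>) j
      = coeff (pCons 0 (pderiv (phi n k \<eta>)) - smult (real k) (phi n k \<eta>)) j"
    using assms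
    by (cases j) (auto simp: coeff_chi coeff_phi coeff_pderiv algebra_simps simp del: of_nat_Suc)
qed

lemma DERIV_phi_over_power:
  assumes "k \<le> n" "x > 0"
  shows "((\<lambda>x. poly (phi n k \<eta>) x / x ^ k) has_real_derivative
    poly (chi n k \<eta>) x / x ^ Suc k) (at x)"
proof -
  have "((\<lambda>x. poly (phi n k \<eta>) x / x ^ k) has_real_derivative
      (poly (pderiv (phi n k \<eta>)) x * x ^ k - poly (phi n k \<eta>) x * (real k * x ^ (k - 1)))
        / (x ^ k * x ^ k)) (at x)"
    using assms by (auto intro!: derivative_eq_intros)
  \<comment> \<open>The case split handles the truncated \<open>k - 1\<close>: for
    \<open>k = 0\<close> the factor \<open>real k\<close> kills that term, otherwise
    \<open>x ^ (k - 1)\<close> cancels.\<close>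
  also have "(poly (pderiv (phi n k \<eta>)) x * x ^ k - poly (phi n k \<eta>) x * (real k * x ^ (k - 1)))
      / (x ^ k * x ^ k) = poly (chi n k \<eta>) x / x ^ Suc k"
    using assms by (cases k) (auto simp: chi_eq_pderiv_phi field_simps)
  finally show ?thesis .
qed

text \<open>Up to the positive factor \<open>x ^ k * y ^ k\<close>, the second factor is the
  increment of \<open>t ^ (j - k)\<close> from \<open>x\<close> to \<open>y\<close>, which has the
  sign of \<open>j - k\<close>. Clearing denominators avoids negative exponents.\<close>

lemma diff_mult_power_diff_nonneg:
  fixes x y :: real
  assumes "0 < x" "x < y"
  shows "(real j - real k) * (y ^ j * x ^ k - x ^ j * y ^ k) \<ge> 0"
proof (cases "k \<le> j")
  case True
  then obtain d where "j = k + d" by (auto simp: le_iff_add)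
  moreover have "x ^ d \<le> y ^ d" using assms by (intro power_mono) auto
  ultimately show ?thesis using assms by (simp add: power_add mult_ac)
next
  case False
  then obtain d where "k = j + d" by (metis le_iff_add nat_le_linear)
  moreover have "x ^ d \<le> y ^ d" using assms by (intro power_mono) auto
  ultimately show ?thesis
    using assms by (auto simp: power_add mult_ac intro!: mult_nonneg_nonpos)
qed

lemma chi_over_power_strict_mono:
  assumes "0 < k" "\<And>j. j \<le> n \<Longrightarrow> \<eta> j \<ge> 0" "\<eta> 0 > 0" "0 < x" "x < y"
  shows "poly (chi n k \<eta>) x / x ^ k < poly (chi n k \<eta>) y / y ^ k"
proof -
  have "poly (chi n k \<eta>) y * x ^ k - poly (chi n k \<eta>) x * y ^ k
      = (\<Sum>j=0..n. \<eta> j * ((real j - real k) * (y ^ j * x ^ k - x ^ j * y ^ k)))"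
    unfolding chi_def poly_sum poly_monom sum_distrib_right sum_subtractf[symmetric]
    by (intro sum.cong) (auto simp: algebra_simps)
  also have "\<dots> > 0"
  proof (rule sum_pos2[of _ 0])
    have "x ^ k < y ^ k" using assms by (intro power_strict_mono) auto
    then show "\<eta> 0 * ((real 0 - real k) * (y ^ 0 * x ^ k - x ^ 0 * y ^ k)) > 0"
      using assms by (simp add: mult_less_0_iff)
    show "\<eta> j * ((real j - real k) * (y ^ j * x ^ k - x ^ j * y ^ k)) \<ge> 0" if "j \<in> {0..n}" for j
      using that assms diff_mult_power_diff_nonneg[of x y j k]
      by (intro mult_nonneg_nonneg[of "\<eta> j"]) auto
  qed auto
  finally show ?thesis using assms by (simp add: field_simps)
qed

text \<open>A positive leading coefficient eventually bounds the polynomial from below. This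
  supplies right endpoints for the intermediate value theorem, for both \<open>chi\<close> and
  \<open>phi\<close>.\<close>

lemma poly_pos_beyond:
  fixes p :: "real poly"
  assumes "coeff p n > 0" "\<And>j. j > n \<Longrightarrow> coeff p j = 0"
  shows "\<exists>y>x. poly p y > 0"
proof -
  have "degree p = n"
    using assms by (metis degree_le le_antisym le_degree less_irrefl)
  then have lc: "lead_coeff p > 0" using assms by simp
  then obtain b where "\<forall>y\<ge>b. poly p y \<ge> lead_coeff p"
    using poly_pinfty_gt_lc by blast
  with lc have "max b (x + 1) > x \<and> poly p (max b (x + 1)) > 0"
    by (auto intro: less_le_trans)
  then show ?thesis by blast
qed

theorem theorem2p1:
  fixes n k :: nat and \<eta> :: "nat \<Rightarrow> real"
  assumes "n \<ge> 3" and "1 \<le> k" and "k \<le> n - 1"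
    and "\<And>j. j \<le> n - 1 \<Longrightarrow> \<eta> j \<ge> 0"
    and "\<eta> n = 1"
    and "\<eta> 0 * \<eta> k \<noteq> 0"
  shows "(\<exists>!x. x > 0 \<and> poly (chi n k \<eta>) x = 0) \<and>
    (card {x. x > 0 \<and> poly (phi n k \<eta>) x = 0} = 2 \<longleftrightarrow>
      poly (phi n k \<eta>) (THE x. x > 0 \<and> poly (chi n k \<eta>) x = 0) < 0)"
proof -
  let ?\<phi> = "poly (phi n k \<eta>)" and ?\<chi> = "poly (chi n k \<eta>)"
  define f where "f x = ?\<phi> x / x ^ k" for x
  have k: "0 < k" "k < n" using assms by auto
  have \<eta>_nonneg: "\<eta> j \<ge> 0" if "j \<le> n" for j
    using that assms(1,4,5) by (cases "j = n") auto
  have \<eta>0: "\<eta> 0 > 0" using \<eta>_nonneg[of 0] assms(6) by (simp add: less_le)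
  have \<phi>0: "?\<phi> 0 > 0" using k \<eta>0 by (simp add: poly_0_coeff_0 coeff_phi)
  have \<chi>0: "?\<chi> 0 < 0" using k \<eta>0 by (simp add: poly_0_coeff_0 coeff_chi)
  have "\<exists>b>0. ?\<chi> b > 0"
    by (rule poly_pos_beyond[where n = n]) (use k assms(5) in \<open>auto simp: coeff_chi\<close>)
  then obtain b where b: "b > 0" "?\<chi> b > 0" by blast
  obtain s where s: "s > 0" "?\<chi> s = 0"
    using poly_IVT_pos[OF b(1) \<chi>0 b(2)] by blast
  have \<chi>_mono: "?\<chi> x / x ^ k < ?\<chi> y / y ^ k" if "0 < x" "x < y" for x y
    by (rule chi_over_power_strict_mono) (use that k \<eta>_nonneg \<eta>0 in simp_all)
  have \<chi>_neg: "?\<chi> x < 0" if "0 < x" "x < s" for x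
    using \<chi>_mono[OF that] that s by (simp add: divide_less_0_iff)
  have \<chi>_pos: "?\<chi> x > 0" if "s < x" for x
    using \<chi>_mono[OF s(1) that] that s by (simp add: zero_less_divide_iff)
  have s_unique: "x = s" if "x > 0" "?\<chi> x = 0" for x
    using \<chi>_neg[of x] \<chi>_pos[of x] that by (metis less_irrefl linorder_neqE)
  have ex1: "\<exists>!x. x > 0 \<and> ?\<chi> x = 0"
    using s s_unique by blast
  have the_s: "(THE x. x > 0 \<and> ?\<chi> x = 0) = s"
    using s s_unique by blast

  have DERIV_f: "(f has_real_derivative ?\<chi> x / x ^ Suc k) (at x)" if "x > 0" for x
    unfolding f_def using DERIV_phi_over_power[of k n x] k that by simp
  have f_cont: "continuous_on {x..y} f" if "x > 0" for x y
    by (intro continuous_at_imp_continuous_on ballI DERIV_isCont[OF DERIV_f]) (use that in auto)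
  have f_decreasing: "f y < f x" if "0 < x" "x < y" "y \<le> s" for x y
  \<comment> \<open>The derivative vanishes at \<open>s\<close>, so its sign is required only on the
    open interval; this admits \<open>y = s\<close>.\<close>
  proof (rule DERIV_neg_imp_decreasing_open[OF that(2) _ f_cont[OF that(1)]])
    fix z assume "x < z" "z < y"
    then show "\<exists>d. (f has_real_derivative d) (at z) \<and> d < 0"
      using that \<chi>_neg[of z] DERIV_f[of z] by (intro exI[of _ "?\<chi> z / z ^ Suc k"])
        (auto simp: divide_less_0_iff simp del: power_Suc)
  qed
  have f_increasing: "f x < f y" if "s \<le> x" "x < y" for x y
  proof (rule DERIV_pos_imp_increasing_open[OF that(2) _ f_cont])
    fix z assume "x < z" "z < y"
    then show "\<exists>d. (f has_real_derivative d) (at z) \<and> 0 < d"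
      using that s \<chi>_pos[of z] DERIV_f[of z] by (intro exI[of _ "?\<chi> z / z ^ Suc k"])
        (auto simp: zero_less_divide_iff simp del: power_Suc)
  qed (use s that in auto)
  have f_zero_iff: "f x = 0 \<longleftrightarrow> ?\<phi> x = 0" if "x > 0" for x
    using that by (simp add: f_def)
  \<comment> \<open>This gives at most one positive root of \<open>phi\<close> on each side of
    \<open>s\<close>.\<close>
  have f_inj: "x = y" if "f x = f y" "0 < x" "x \<le> s \<and> y \<le> s \<or> s \<le> x \<and> s \<le> y" "0 < y" for x y
    using that f_decreasing[of x y] f_decreasing[of y x] f_increasing[of x y] f_increasing[of y x]
    by (cases x y rule: linorder_cases) auto

  have "card {x. x > 0 \<and> ?\<phi> x = 0} = 2" if neg: "?\<phi> s < 0"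
  proof -
    \<comment> \<open>The sign change is read off from \<open>phi\<close> itself, since
      \<open>f 0\<close> is only the default value of a division by zero.\<close>
    obtain r where r: "0 < r" "r < s" "?\<phi> r = 0"
      using poly_IVT_neg[OF s(1) \<phi>0 neg] by blast
    have "\<exists>c>s. ?\<phi> c > 0"
      by (rule poly_pos_beyond[where n = n]) (use k assms(5) in \<open>auto simp: coeff_phi\<close>)
    then obtain c where c: "c > s" "?\<phi> c > 0" by blast
    obtain t where t: "s < t" "?\<phi> t = 0"
      using poly_IVT_pos[OF c(1) neg c(2)] by blast
    have "x = r \<or> x = t" if "x > 0" "?\<phi> x = 0" for x
      using that r t s f_inj[of x r] f_inj[of x t] f_zero_iff[of x] f_zero_iff[of r] f_zero_iff[of t]
      by (cases "x \<le> s") auto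
    then have "{x. x > 0 \<and> ?\<phi> x = 0} = {r, t}" using r s t by auto
    then show ?thesis using r t by simp
  qed
  moreover have "?\<phi> s < 0" if two: "card {x. x > 0 \<and> ?\<phi> x = 0} = 2"
  proof (rule ccontr)
    assume "\<not> ?\<phi> s < 0"
    then have "f s \<ge> 0" using s by (simp add: f_def)
    \<comment> \<open>Every other positive point has a value of \<open>f\<close> strictly above the
      minimum \<open>f s\<close>, hence positive. A multiple root at \<open>s\<close> counts once in
      the set.\<close>
    then have "x = s" if "x > 0" "?\<phi> x = 0" for x
      using that f_zero_iff[of x] f_decreasing[of x s] f_increasing[of s x]
      by (cases x s rule: linorder_cases) auto
    then have "{x. x > 0 \<and> ?\<phi> x = 0} \<subseteq> {s}" by auto
    then have "card {x. x > 0 \<and> ?\<phi> x = 0} \<le> 1"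
      using card_mono[of "{s}"] by auto
    with two show False by simp
  qed
  ultimately show ?thesis using ex1 the_s by auto
qed

end
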